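(* For $p\in\mathbb{R}$ let $\mathcal{G}_p(x)=e^{\mathcal{K}(\sqrt{x})}-\dfrac{p}{\sqrt{1-x}}$ for $x\in(0,1)$. Then the following statements hold. (i) $\mathcal{G}_p$ is absolutely monotonic on $(0,1)$ if and only if $p\le \pi e^{\pi/2}/4=3.778\ldots$, and $-\mathcal{G}_p$ is absolutely monotonic on $(0,1)$ if and only if $p\ge e^{\pi/2}$. (ii) For every $k\in\mathbb{N}=\{1,2,3,\dots\}$, the $k$-th derivative $\mathcal{G}_p^{(k)}$ is absolutely monotonic on $(0,1)$ if and only if $p\le b_k/W_k$, and $-\mathcal{G}_p^{(k)}$ is absolutely monotonic on $(0,1)$ if and only if $p\ge 4$.
   Context: $\mathcal{K}(r)=\int_0^{\pi/2}\frac{dt}{\sqrt{1-r^2\sin^2 t}}$ for $r\in(0,1)$ is the complete elliptic integral of the first kind, so that $\mathcal{K}(\sqrt{x})=\frac{\pi}{2}\sum_{n=0}^\infty W_n^2x^n$ for $x\in(0,1)$, where $W_n=\frac{(2n-1)!!}{(2n)!!}=\frac{\Gamma(n+1/2)}{\Gamma(1/2)\Gamma(n+1)}$ (so $W_0=1$); the $W_n$ are the Maclaurin coefficients of $1/\sqrt{1-x}=\sum_{n=0}^\infty W_nx^n$. The numbers $b_n$ ($n\ge0$) are the Maclaurin coefficients of $e^{\mathcal{K}(\sqrt{x})}=\sum_{n=0}^\infty b_nx^n$ on $(0,1)$. A function $f$ is absolutely monotonic on an interval $I$ if it is infinitely differentiable there and $f^{(j)}(x)\ge0$ for all $x\in I$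 and all integers $j\ge0$. *)

theory Defs
  imports "HOL-Analysis.Analysis"
begin

definition ellK :: "real \<Rightarrow> real" where
  "ellK r = integral {0..pi/2} (\<lambda>t. 1 / sqrt (1 - r\<^sup>2 * (sin t)\<^sup>2))"

(* the quotient of double factorials (2n-1)!! / (2n)!! *)
definition W :: "nat \<Rightarrow> real" where
  "W n = (\<Prod>i=1..n. 2 * real i - 1) / (\<Prod>i=1..n. 2 * real i)"

(* Maclaurin coefficients of exp (ellK (sqrt x)), pinned down by the expansion on (0,1).
   Iterated derivatives of \<lambda>x. exp (ellK (sqrt x)) at 0 would not give them: sqrt is odd
   in HOL, so for x < 0 this function sees \<bar>x\<bar> instead of x. *)
definition b :: "nat \<Rightarrow> real" where
  "b = (THE c. \<forall>x\<in>{0<..<1}. (\<lambda>n. c n * x ^ n) sums exp (ellK (sqrt x)))"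

definition G :: "real \<Rightarrow> real \<Rightarrow> real" where
  "G p x = exp (ellK (sqrt x)) - p / sqrt (1 - x)"

(* Intended for open I, where the derivatives depend only on the values of f on I. *)
definition absolutely_monotonic_on :: "real set \<Rightarrow> (real \<Rightarrow> real) \<Rightarrow> bool" where
  "absolutely_monotonic_on I f \<longleftrightarrow>
     (\<forall>j. \<forall>x\<in>I. (deriv ^^ j) f field_differentiable (at x) \<and> 0 \<le> (deriv ^^ j) f x)"

end

theory Submission
  imports Defs "HOL-Real_Asymp.Real_Asymp"
begin

text \<open>
  Both $e^{\mathcal K(\sqrt x)}$ and $1/\sqrt{1-x}$ are sums of power series on $(0,1)$, so
  $\mathcal G_p$ is one, with coefficients $b_n - p W_n$. Letting $x \to 0$ in a derivative
  isolates one coefficient, hence the $k$-th derivative of such a sum is absolutely monotonic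
  on $(0,1)$ exactly when all coefficients with index $n \ge k$ are nonnegative
  (\<open>absolutely_monotonic_higher_deriv_iff\<close>). Everything therefore reduces to the infimum and the
  supremum of $\beta_n = b_n / W_n$ over $n \ge k$. Here $\beta_0 = e^{\pi/2}$ is the largest value
  of all and $\beta_1 = \pi e^{\pi/2}/4$, and what has to be shown is that $\beta_n$ increases for
  $n \ge 1$ and that $4$ is its supremum.

  The sequence increases where $g_n = (2n+2) b_{n+1} - (2n+1) b_n \ge 0$. With
  $F(x) = e^{\mathcal K(\sqrt x)}$ and $'$ the derivative with respect to $x$, these numbers are
  the coefficients of $2(1-x)F' - F = F C$, where $C = 2(1-x)\,(\mathcal K(\sqrt x))' - 1$ has the
  coefficients $c_0 = \pi/4 - 1 < 0$ and $c_n = \frac{\pi}{4} W_n^2/(n+1) > 0$ for $n \ge 1$. Their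
  partial sums are $-\tau_n$ with $\tau_n = 1 - \pi(n+1)W_{n+1}^2$, which tends to $0$ by Wallis'
  product, so
  $$g_n = \sum_{k=1}^n c_k (b_{n-k} - b_n) - \tau_n b_n.$$
  Thus positivity of $g_n$ asks for a lower bound on how fast $b$ decreases. It is obtained inside
  a strong induction: as long as $\beta_1 \le \dots \le \beta_j$, the terms of the convolution
  $g_j$ can be bounded from above by a multiple of $\beta_j$, and
  $\sum_k W_k W_{n-k}/(k+1) = 2W_{n+1}$ yields
  $g_j \le (\frac{\pi}{4} - \frac12) b_j$ (\<open>gap_upper\<close>), which says that $b$ falls by at least a
  fixed fraction of $b_j/(j+1)$ from $j$ to $j+1$. Together with $b_n \le b_0 W_n$, which serves
  for the term $k = n$, what remains is an inequality about $W_n$ alone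
  (\<open>weighted_gap_coeff_bound\<close>). It holds for $n \ge 4$; the cases $n \le 3$ are polynomial
  inequalities in $\pi$.

  The value $4$ comes from $\mathcal K(r) = \ln (4/r') + o(1)$ with $r' = \sqrt{1-r^2}$
  (\<open>exp_ellK_asymptotic\<close>): it gives $\sqrt{1-x}\, F(x) \to 4$ as $x \to 1$, and then a bound
  $b_n \le p W_n$ or $b_n \ge p W_n$ for all large $n$ forces $4 \le p$ or $4 \ge p$
  (\<open>eventual_ratio_bounds\<close>).
\<close>

section \<open>Power series on the unit interval\<close>

text \<open>The expansion is required on the open interval $(0,1)$ only, since a function built from
  $\sqrt x$ agrees with the sum of the series there but not for negative $x$.\<close>

definition has_power_series :: "(real \<Rightarrow> real) \<Rightarrow> (nat \<Rightarrow> real) \<Rightarrow> bool" where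
  "has_power_series f c \<longleftrightarrow> (\<forall>x\<in>{0<..<1}. (\<lambda>n. c n * x ^ n) sums f x)"

lemma has_power_series_summable:
  assumes "has_power_series f c" "\<bar>x\<bar> < 1"
  shows "summable (\<lambda>n. c n * x ^ n)"
proof -
  define y where "y = (1 + \<bar>x\<bar>) / 2"
  have y: "y \<in> {0<..<1}" "\<bar>x\<bar> < \<bar>y\<bar>"
    using assms(2) by (auto simp: y_def field_simps)
  have "summable (\<lambda>n. c n * y ^ n)"
    using assms(1) y(1) unfolding has_power_series_def by (blast intro: sums_summable)
  then show ?thesis
    by (rule powser_inside) (use y(2) in simp)
qed

lemma has_power_series_deriv:
  assumes "has_power_series f c"
  shows "has_power_series (deriv f) (diffs c)"
    and "x \<in> {0<..<1} \<Longrightarrow> f field_differentiable at x"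
proof -
  have der: "(f has_field_derivative (\<Sum>n. diffs c n * x ^ n)) (at x)" if x: "x \<in> {0<..<1}" for x
  proof -
    have "((\<lambda>x. \<Sum>n. c n * x ^ n) has_field_derivative (\<Sum>n. diffs c n * x ^ n)) (at x)"
      using x by (intro termdiffs_strong'[of 1] has_power_series_summable[OF assms]) auto
    then show ?thesis
      by (rule has_field_derivative_transform_within_open[where S = "{0<..<1}"])
        (use x assms in \<open>auto simp: has_power_series_def sums_iff\<close>)
  qed
  show "has_power_series (deriv f) (diffs c)"
    unfolding has_power_series_def
  proof
    fix x :: real assume x: "x \<in> {0<..<1}"
    have "summable (\<lambda>n. diffs c n * x ^ n)"
      using x has_power_series_summable[OF assms] by (intro termdiff_converges[of x 1]) auto
    then show "(\<lambda>n. diffs c n * x ^ n) sums deriv f x"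
      using DERIV_imp_deriv[OF der[OF x]] by (simp add: sums_iff)
  qed
  show "x \<in> {0<..<1} \<Longrightarrow> f field_differentiable at x"
    using der by (auto simp: field_differentiable_def)
qed

lemma has_power_series_higher_deriv:
  "has_power_series f c \<Longrightarrow> has_power_series ((deriv ^^ j) f) ((diffs ^^ j) c)"
  by (induction j) (auto intro: has_power_series_deriv(1))

lemma higher_diffs: "(diffs ^^ j) c n = (fact (n + j) / fact n) * (c (n + j) :: real)"
proof (induction j arbitrary: n)
  case (Suc j)
  have "(diffs ^^ Suc j) c n = real (Suc n) * ((fact (Suc n + j) / fact (Suc n)) * c (Suc n + j))"
    by (simp add: diffs_def Suc)
  then show ?case by (simp add: divide_simps)
qed simp

text \<open>The sum of the series is continuous on the full disc of convergence, which supplies the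
  one-sided limit although \<open>f\<close> itself is arbitrary outside $(0,1)$.\<close>

lemma has_power_series_limit_0:
  assumes "has_power_series f c"
  shows "(f \<longlongrightarrow> c 0) (at_right 0)"
proof -
  have "((\<lambda>x. \<Sum>n. c n * x ^ n) \<longlongrightarrow> c 0) (at 0)"
    by (rule powser_limit_0[of 1]) (auto intro!: summable_sums has_power_series_summable[OF assms])
  then have "((\<lambda>x. \<Sum>n. c n * x ^ n) \<longlongrightarrow> c 0) (at_right 0)"
    by (rule tendsto_mono[OF at_le, rotated]) auto
  moreover have "\<forall>\<^sub>F x in at_right 0. (\<Sum>n. c n * x ^ n) = f x"
    unfolding eventually_at_right_field using assms
    by (intro exI[of _ 1]) (auto simp: has_power_series_def sums_iff)
  ultimately show ?thesis
    by (rule Lim_transform_eventually)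
qed

lemma higher_deriv_limit_0:
  assumes "has_power_series f c"
  shows "((deriv ^^ j) f \<longlongrightarrow> fact j * c j) (at_right 0)"
  using has_power_series_limit_0[OF has_power_series_higher_deriv[OF assms, of j]]
  by (simp add: higher_diffs)

lemma has_power_series_unique:
  assumes "has_power_series f c" "has_power_series f c'"
  shows "c = c'"
proof
  fix j
  have "fact j * c j = fact j * c' j"
    using tendsto_unique[OF _ higher_deriv_limit_0[OF assms(1)] higher_deriv_limit_0[OF assms(2)]]
    by simp
  then show "c j = c' j" by simp
qed

lemma has_power_series_uminus:
  "has_power_series f c \<Longrightarrow> has_power_series (\<lambda>x. - f x) (\<lambda>n. - c n)"
  by (auto simp: has_power_series_def intro!: sums_minus)

text \<open>Nonnegative coefficients make each differentiated series nonnegative termwise; conversely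
  the $n$-th coefficient is recovered, up to the factor $n!$, as the limit at $0$ of the $n$-th
  derivative.\<close>

lemma absolutely_monotonic_iff_coeffs:
  assumes "has_power_series f c"
  shows "absolutely_monotonic_on {0<..<1} f \<longleftrightarrow> (\<forall>n. 0 \<le> c n)"
proof
  assume *: "absolutely_monotonic_on {0<..<1} f"
  show "\<forall>n. 0 \<le> c n"
  proof
    fix n
    have "\<forall>\<^sub>F x in at_right 0. 0 \<le> (deriv ^^ n) f x"
      unfolding eventually_at_right_field using *
      by (intro exI[of _ 1]) (auto simp: absolutely_monotonic_on_def)
    then have "0 \<le> fact n * c n"
      using tendsto_lowerbound[OF higher_deriv_limit_0[OF assms]] by fastforce
    then show "0 \<le> c n" using mult_le_cancel_left_pos[of "fact n" 0 "c n"] by simp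
  qed
next
  assume c: "\<forall>n. 0 \<le> c n"
  show "absolutely_monotonic_on {0<..<1} f"
    unfolding absolutely_monotonic_on_def
  proof (intro allI ballI conjI)
    fix j and x :: real assume x: "x \<in> {0<..<1}"
    note s = has_power_series_higher_deriv[OF assms, of j]
    show "(deriv ^^ j) f field_differentiable at x"
      by (rule has_power_series_deriv(2)[OF s x])
    have "(\<lambda>n. (diffs ^^ j) c n * x ^ n) sums (deriv ^^ j) f x"
      using s x by (auto simp: has_power_series_def)
    then show "0 \<le> (deriv ^^ j) f x"
      by (rule sums_le[OF _ sums_zero, rotated]) (use c x in \<open>auto simp: higher_diffs\<close>)
  qed
qed

lemma absolutely_monotonic_higher_deriv_iff:
  assumes "has_power_series f c"
  shows "absolutely_monotonic_on {0<..<1} ((deriv ^^ k) f) \<longleftrightarrow> (\<forall>n\<ge>k. 0 \<le> c n)" (is ?pos)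
    and "absolutely_monotonic_on {0<..<1} (\<lambda>x. - (deriv ^^ k) f x) \<longleftrightarrow> (\<forall>n\<ge>k. c n \<le> 0)" (is ?neg)
proof -
  note s = has_power_series_higher_deriv[OF assms, of k]
  note m = has_power_series_uminus[OF s]
  have shift: "(\<forall>n. P (n + k)) \<longleftrightarrow> (\<forall>n\<ge>k. P n)" for P
    by (auto simp: le_iff_add add.commute)
  have "0 \<le> (diffs ^^ k) c n \<longleftrightarrow> 0 \<le> c (n + k)" "0 \<le> - (diffs ^^ k) c n \<longleftrightarrow> c (n + k) \<le> 0" for n
    using mult_le_cancel_left_pos[of "fact (n + k) / fact n" 0 "c (n + k)"]
      mult_le_cancel_left_pos[of "fact (n + k) / fact n" "c (n + k)" 0]
    unfolding higher_diffs by simp_all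
  then show ?pos ?neg
    unfolding absolutely_monotonic_iff_coeffs[OF s] absolutely_monotonic_iff_coeffs[OF m]
    using shift[of "\<lambda>n. 0 \<le> c n"] shift[of "\<lambda>n. c n \<le> 0"] by auto
qed

text \<open>The finitely many terms that may be negative stay bounded on $(0,1)$. This is how a sign
  condition on the coefficients is turned into information on the growth at $1$.\<close>

lemma bounded_below_if_coeffs_eventually_nonneg:
  assumes "has_power_series f c" "\<And>n. m \<le> n \<Longrightarrow> 0 \<le> c n"
  obtains M where "\<And>x. x \<in> {0<..<1} \<Longrightarrow> - M \<le> f x"
proof
  fix x :: real assume x: "x \<in> {0<..<1}"
  have s: "(\<lambda>n. c n * x ^ n) sums f x"
    using assms(1) x by (simp add: has_power_series_def)
  have "- (\<Sum>n<m. \<bar>c n\<bar>) \<le> (\<Sum>n<m. c n * x ^ n)"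
    unfolding sum_negf[symmetric]
  proof (rule sum_mono)
    fix n
    have "\<bar>c n * x ^ n\<bar> \<le> \<bar>c n\<bar>"
      using x by (simp add: abs_mult power_abs power_le_one mult_left_le)
    then show "- \<bar>c n\<bar> \<le> c n * x ^ n" by linarith
  qed
  also have "\<dots> \<le> (\<Sum>n. c n * x ^ n)"
    using assms(2) x by (intro sum_le_suminf sums_summable[OF s]) auto
  finally show "- (\<Sum>n<m. \<bar>c n\<bar>) \<le> f x"
    using s by (simp add: sums_iff)
qed

section \<open>The Maclaurin coefficients of the inverse square root\<close>

lemma W_0 [simp]: "W 0 = 1"
  by (simp add: W_def)

lemma W_Suc: "W (Suc n) = W n * (2 * real n + 1) / (2 * real n + 2)"
  by (simp add: W_def field_simps)

lemma W_pos [simp]: "0 < W n"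
  by (induction n) (auto simp: W_Suc intro!: divide_pos_pos mult_pos_pos)

lemma W_nonzero [simp]: "W n \<noteq> 0"
  using W_pos[of n] by linarith

lemma W_Suc_sq: "(W (Suc n))\<^sup>2 = (W n)\<^sup>2 * ((2 * real n + 1)\<^sup>2 / (2 * real n + 2)\<^sup>2)"
  by (simp add: W_Suc power_mult_distrib power_divide)

lemma W_eq_gbinomial: "W n = (-1) ^ n * ((-1/2) gchoose n)"
proof (induction n)
  case (Suc n)
  have *: "((-1/2) gchoose Suc n) = ((-1/2) gchoose n) * (- 1/2 - real n) / (real n + 1)"
    using gbinomial_mult_1[of "-1/2 :: real" n] by (simp add: field_simps)
  then show ?case
    unfolding W_Suc Suc * by (simp add: field_simps)
qed simp

lemma W_sums:
  assumes "\<bar>x\<bar> < 1"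
  shows "(\<lambda>n. W n * x ^ n) sums (1 / sqrt (1 - x))"
proof -
  have "(\<lambda>n. ((-1/2) gchoose n) * (- x) ^ n) sums (1 + - x) powr (-1/2)"
    using gen_binomial_real[of "-x" "-1/2"] assms by simp
  moreover have "(1 + - x) powr (-1/2) = 1 / sqrt (1 - x)"
    using assms by (simp add: powr_minus_divide powr_half_sqrt)
  moreover have "((-1/2) gchoose n) * (- x) ^ n = W n * x ^ n" for n
    by (simp add: W_eq_gbinomial power_minus[of x])
  ultimately show ?thesis by simp
qed

lemma W_mono_decr: "W (Suc n) \<le> W n"
  using W_pos[of n] by (simp add: W_Suc field_simps)

lemma W_le: "m \<le> n \<Longrightarrow> W n \<le> W m"
  by (rule lift_Suc_antimono_le[of W]) (auto intro: W_mono_decr)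

text \<open>Both sides are the coefficients of $(1-x)^{-3/2} = (1-x)^{-1} (1-x)^{-1/2}$.\<close>

lemma sum_W: "(\<Sum>k\<le>n. W k) = (2 * real n + 1) * W n"
  by (induction n) (simp_all add: W_Suc field_simps)

text \<open>Wallis' product: its $n$-th partial product is $1/((2n+1)W_n^2)$.\<close>

lemma shifted_W_sq_limit: "(\<lambda>n. (real n + s) * (W n)\<^sup>2) \<longlonglongrightarrow> 1 / pi"
proof -
  have eq: "(\<Prod>k=1..n. (4 * real k^2) / (4 * real k^2 - 1)) = 1 / ((2 * real n + 1) * (W n)\<^sup>2)" for n
  proof (induction n)
    case (Suc n)
    have *: "4 * (real (Suc n))\<^sup>2 - 1 = (2 * real n + 1) * (2 * real n + 3)"
      "4 * (real (Suc n))\<^sup>2 = (2 * real n + 2)\<^sup>2"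
      by (simp_all add: power2_eq_square algebra_simps)
    have "(\<Prod>k=1..Suc n. (4 * real k^2) / (4 * real k^2 - 1)) =
       1 / ((2 * real n + 1) * (W n)\<^sup>2) * ((2 * real n + 2)\<^sup>2 / ((2 * real n + 1) * (2 * real n + 3)))"
      using Suc * by (simp add: prod.atLeast_Suc_atMost)
    also have "\<dots> = 1 / ((2 * real (Suc n) + 1) * (W (Suc n))\<^sup>2)"
      using W_pos[of n] by (simp add: W_Suc divide_simps) (simp add: power2_eq_square algebra_simps)
    finally show ?case .
  qed simp
  have "(\<lambda>n. 1 / ((2 * real n + 1) * (W n)\<^sup>2)) \<longlonglongrightarrow> pi / 2"
    using wallis unfolding eq .
  from tendsto_inverse[OF this]
  have "(\<lambda>n. (2 * real n + 1) * (W n)\<^sup>2) \<longlonglongrightarrow> 2 / pi"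
    by (simp add: field_simps)
  moreover have "(\<lambda>n. (real n + s) / (2 * real n + 1)) \<longlonglongrightarrow> 1 / 2"
    by real_asymp
  ultimately have "(\<lambda>n. (real n + s) / (2 * real n + 1) * ((2 * real n + 1) * (W n)\<^sup>2)) \<longlonglongrightarrow> 1 / 2 * (2 / pi)"
    by (intro tendsto_mult)
  moreover have "(real n + s) / (2 * real n + 1) * ((2 * real n + 1) * (W n)\<^sup>2) = (real n + s) * (W n)\<^sup>2" for n
    by (simp add: divide_simps)
  ultimately show ?thesis by simp
qed

text \<open>Since $W_n^2 \approx 1/(\pi (n + \frac14))$, a shift $s > \frac14$ makes $(n+s)W_n^2$
  decrease to $1/\pi$ from some index on; the first hypothesis says that \<open>n\<close> has reached it.\<close>

lemma shifted_W_sq_decreasing: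
  assumes "1 - 3 * s \<le> (4 * s - 1) * real n" "0 \<le> s"
  shows "(real (Suc n) + s) * (W (Suc n))\<^sup>2 \<le> (real n + s) * (W n)\<^sup>2"
proof -
  have "(real (Suc n) + s) * (2 * real n + 1)\<^sup>2 \<le> (real n + s) * (2 * real n + 2)\<^sup>2"
    using assms by (simp add: power2_eq_square algebra_simps)
  then have "(real (Suc n) + s) * (2 * real n + 1)\<^sup>2 / (2 * real n + 2)\<^sup>2 \<le> real n + s"
    by (subst pos_divide_le_eq) auto
  from mult_right_mono[OF this, of "(W n)\<^sup>2"] show ?thesis
    by (simp add: W_Suc_sq ac_simps)
qed

lemma W_sq_lower:
  assumes "1 - 3 * s \<le> (4 * s - 1) * real n" "1 / 4 \<le> s"
  shows "1 / pi \<le> (real n + s) * (W n)\<^sup>2"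
proof -
  have "decseq (\<lambda>k. (real (n + k) + s) * (W (n + k))\<^sup>2)"
  proof (rule decseq_SucI)
    fix k
    have "(4 * s - 1) * real n \<le> (4 * s - 1) * real (n + k)"
      using assms(2) by (intro mult_left_mono) auto
    then show "(real (n + Suc k) + s) * (W (n + Suc k))\<^sup>2 \<le> (real (n + k) + s) * (W (n + k))\<^sup>2"
      using assms shifted_W_sq_decreasing[of s "n + k"] by simp
  qed
  moreover have "(\<lambda>k. (real (n + k) + s) * (W (n + k))\<^sup>2) \<longlonglongrightarrow> 1 / pi"
    using LIMSEQ_ignore_initial_segment[OF shifted_W_sq_limit[of s], of n] by (simp add: add.commute)
  ultimately have "1 / pi \<le> (real (n + 0) + s) * (W (n + 0))\<^sup>2"
    by (rule decseq_ge)
  then show ?thesis by simp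
qed

text \<open>With shift $0$ the sequence $(n+s)W_n^2$ increases to its limit $1/\pi$.\<close>

lemma W_sq_upper: "pi * real n * (W n)\<^sup>2 \<le> 1"
proof -
  have "incseq (\<lambda>n. (real n + 0) * (W n)\<^sup>2)"
  proof (rule incseq_SucI)
    fix n
    have "real n * (2 * real n + 2)\<^sup>2 \<le> (real n + 1) * (2 * real n + 1)\<^sup>2"
      by (simp add: power2_eq_square algebra_simps)
    then have "real n \<le> (real n + 1) * (2 * real n + 1)\<^sup>2 / (2 * real n + 2)\<^sup>2"
      by (subst pos_le_divide_eq) auto
    from mult_right_mono[OF this, of "(W n)\<^sup>2"]
    show "(real n + 0) * (W n)\<^sup>2 \<le> (real (Suc n) + 0) * (W (Suc n))\<^sup>2"
      by (simp add: W_Suc_sq ac_simps)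
  qed
  from incseq_le[OF this shifted_W_sq_limit[of 0], of n] show ?thesis
    by (simp add: field_simps)
qed

text \<open>Vandermonde's identity for $(1-x)^{1/2} (1-x)^{-1/2} = 1$: up to sign and a factor $2$, the
  numbers $W_k/(k+1)$ are the coefficients of $(1-x)^{1/2}$ after the constant one.\<close>

lemma W_convolution: "(\<Sum>k\<le>n. W k * W (n - k) / (real k + 1)) = 2 * W (Suc n)"
proof -
  have half: "((1/2 :: real) gchoose Suc k) = (-1) ^ k * W k / (2 * (real k + 1))" for k
    using gbinomial_factors[of "-1/2 :: real" k] by (simp add: W_eq_gbinomial field_simps)
  have neg: "((-1/2 :: real) gchoose k) = (-1) ^ k * W k" for k
    by (simp add: W_eq_gbinomial)
  have "0 = (\<Sum>k\<le>Suc n. ((1/2 :: real) gchoose k) * ((-1/2) gchoose (Suc n - k)))"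
    using gbinomial_Vandermonde[of "1/2 :: real" "-1/2" "Suc n"] by (simp add: atLeast0AtMost)
  also have "\<dots> = ((-1/2) gchoose Suc n) + (\<Sum>k\<le>n. ((1/2) gchoose Suc k) * ((-1/2) gchoose (n - k)))"
    by (subst sum.atMost_Suc_shift) simp
  also have "(\<Sum>k\<le>n. ((1/2) gchoose Suc k) * ((-1/2) gchoose (n - k))) =
      (-1) ^ n * (\<Sum>k\<le>n. W k * W (n - k) / (real k + 1)) / 2"
    unfolding half neg sum_distrib_left sum_divide_distrib
  proof (intro sum.cong refl)
    fix k assume "k \<in> {..n}"
    then have "(-1 :: real) ^ n = (-1) ^ k * (-1) ^ (n - k)"
      by (simp flip: power_add)
    then show "(-1) ^ k * W k / (2 * (real k + 1)) * ((-1) ^ (n - k) * W (n - k)) =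
        (-1) ^ n * (W k * W (n - k) / (real k + 1)) / 2"
      by (simp add: divide_simps)
  qed
  finally show ?thesis
    unfolding neg by (simp add: field_simps)
qed

text \<open>One of the factors $W_k$ is at most $\frac12$ because $k \ge 1$; what remains is
  $2W_{n+1} - W_n \le W_n$.\<close>

lemma W_square_convolution_le: "(\<Sum>k=1..n. (W k)\<^sup>2 * W (n - k) / (real k + 1)) \<le> W n / 2"
proof -
  have "(\<Sum>k=1..n. (W k)\<^sup>2 * W (n - k) / (real k + 1)) \<le> (\<Sum>k=1..n. 1 / 2 * (W k * W (n - k) / (real k + 1)))"
  proof (rule sum_mono)
    fix k assume "k \<in> {1..n}"
    then have "W k \<le> 1 / 2"
      using W_le[of 1 k] by (simp add: W_Suc)
    from mult_right_mono[OF this, of "W k * W (n - k) / (real k + 1)"]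
    show "(W k)\<^sup>2 * W (n - k) / (real k + 1) \<le> 1 / 2 * (W k * W (n - k) / (real k + 1))"
      using less_imp_le[OF W_pos] by (simp add: power2_eq_square mult.assoc)
  qed
  also have "\<dots> = 1 / 2 * ((\<Sum>k\<le>n. W k * W (n - k) / (real k + 1)) - W n)"
    unfolding sum_distrib_left[symmetric]
    by (simp add: sum.atLeast_Suc_atMost atLeast0AtMost[symmetric])
  also have "\<dots> \<le> 1 / 2 * W n"
    unfolding W_convolution using W_mono_decr[of n] by simp
  finally show ?thesis by simp
qed

section \<open>Power series of the elliptic integral and of its exponential\<close>

text \<open>The reduction formula: $\cos t \sin^{2n+1} t$ vanishes at both ends, so the integral of its
  derivative $(2n+1)\sin^{2n} t - (2n+2) \sin^{2n+2} t$ is zero.\<close>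

lemma has_integral_sin_even_power:
  "((\<lambda>t. sin t ^ (2 * n)) has_integral (pi / 2 * W n)) {0..pi/2}"
proof (induction n)
  case 0
  show ?case using has_integral_const_real[of "1::real" 0 "pi/2"] by simp
next
  case (Suc n)
  let ?D = "\<lambda>t. (2 * real n + 1) * sin t ^ (2 * n) - (2 * real n + 2) * sin t ^ (2 * Suc n)"
  have "((\<lambda>t. cos t * sin t ^ (2 * n + 1)) has_vector_derivative ?D t) (at t within {0..pi/2})" for t
  proof -
    have "((\<lambda>t. cos t * sin t ^ (2 * n + 1)) has_real_derivative
            (- sin t * sin t ^ (2 * n + 1) + cos t * ((2 * real n + 1) * sin t ^ (2 * n) * cos t)))
            (at t within {0..pi/2})"
      by (rule has_field_derivative_at_within,
          rule DERIV_cong[OF DERIV_mult[OF DERIV_cos DERIV_power[OF DERIV_sin, of "2 * n + 1"]]])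
        (simp add: algebra_simps)
    also have "- sin t * sin t ^ (2 * n + 1) + cos t * ((2 * real n + 1) * sin t ^ (2 * n) * cos t)
        = - (sin t ^ (2 * n) * (sin t)\<^sup>2) + (2 * real n + 1) * sin t ^ (2 * n) * (cos t)\<^sup>2"
      by (simp add: power2_eq_square algebra_simps)
    also have "\<dots> = ?D t"
    proof -
      have *: "sin t ^ (2 * Suc n) = sin t ^ (2 * n) * (sin t)\<^sup>2"
        by (simp add: power2_eq_square)
      show ?thesis
        unfolding * cos_squared_eq by (simp only: algebra_simps)
    qed
    finally show ?thesis by (simp add: has_real_derivative_iff_has_vector_derivative)
  qed
  then have "(?D has_integral (cos (pi/2) * sin (pi/2) ^ (2 * n + 1) - cos 0 * sin 0 ^ (2 * n + 1))) {0..pi/2}"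
    by (intro fundamental_theorem_of_calculus) auto
  then have "(?D has_integral 0) {0..pi/2}" by simp
  from has_integral_diff[OF has_integral_mult_right[OF Suc, of "2 * real n + 1"] this]
  have "((\<lambda>t. (2 * real n + 2) * sin t ^ (2 * Suc n)) has_integral ((2 * real n + 1) * (pi / 2 * W n))) {0..pi/2}"
    by simp
  from has_integral_mult_right[OF this, of "1 / (2 * real n + 2)"]
  have "((\<lambda>t. 1 / (2 * real n + 2) * ((2 * real n + 2) * sin t ^ (2 * Suc n))) has_integral
      1 / (2 * real n + 2) * ((2 * real n + 1) * (pi / 2 * W n))) {0..pi/2}" .
  moreover have "1 / (2 * real n + 2) * ((2 * real n + 2) * y) = y" for y by simp
  moreover have "1 / (2 * real n + 2) * ((2 * real n + 1) * (pi / 2 * W n)) = pi / 2 * W (Suc n)"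
    by (simp add: W_Suc)
  ultimately show ?case by (simp only:)
qed

definition ellK_coeff :: "nat \<Rightarrow> real" where
  "ellK_coeff n = pi / 2 * (W n)\<^sup>2"

text \<open>The binomial series of the integrand converges uniformly in \<open>t\<close>, dominated by
  $\sum W_n x^n$, and is integrated termwise.\<close>

lemma ellK_power_series: "has_power_series (\<lambda>x. ellK (sqrt x)) ellK_coeff"
  unfolding has_power_series_def
proof
  fix x :: real assume x: "x \<in> {0<..<1}"
  let ?f = "\<lambda>n t. \<Sum>i<n. W i * x ^ i * sin t ^ (2 * i)"
  have s: "(\<lambda>i. W i * x ^ i * sin t ^ (2 * i)) sums (1 / sqrt (1 - x * (sin t)\<^sup>2))" for t
  proof -
    have "\<bar>x * (sin t)\<^sup>2\<bar> \<le> x"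
      using x by (simp add: abs_mult abs_square_le_1 mult_left_le)
    then have "\<bar>x * (sin t)\<^sup>2\<bar> < 1" using x by (meson greaterThanLessThan_iff le_less_trans)
    from W_sums[OF this] show ?thesis
      by (simp add: power_mult_distrib power_mult mult.assoc)
  qed
  have "uniform_limit {0..pi/2} ?f (\<lambda>t. \<Sum>i. W i * x ^ i * sin t ^ (2 * i)) sequentially"
  proof (rule Weierstrass_m_test)
    show "norm (W n * x ^ n * sin t ^ (2 * n)) \<le> W n * x ^ n" for n t
      using x by (simp add: abs_mult power_abs abs_of_pos[OF W_pos] power_le_one mult_left_le)
    show "summable (\<lambda>n. W n * x ^ n)"
      using W_sums[of x] x by (auto intro: sums_summable)
  qed
  then have u: "uniform_limit {0..pi/2} ?f (\<lambda>t. 1 / sqrt (1 - x * (sin t)\<^sup>2)) sequentially"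
    using s by (simp add: sums_iff)
  have i: "((\<lambda>t. ?f n t) has_integral (\<Sum>i<n. ellK_coeff i * x ^ i)) {0..pi/2}" for n
  proof (rule has_integral_sum)
    fix i
    show "((\<lambda>t. W i * x ^ i * sin t ^ (2 * i)) has_integral ellK_coeff i * x ^ i) {0..pi/2}"
      using has_integral_mult_right[OF has_integral_sin_even_power[of i], of "W i * x ^ i"]
      by (simp add: ellK_coeff_def power2_eq_square algebra_simps)
  qed simp
  obtain I J where I: "\<And>n. (?f n has_integral I n) {0..pi/2}"
    and J: "((\<lambda>t. 1 / sqrt (1 - x * (sin t)\<^sup>2)) has_integral J) {0..pi/2}" and "I \<longlonglongrightarrow> J"
    by (rule uniform_limit_integral[OF u]) (auto intro!: continuous_intros)
  \<comment> \<open>the integrals of the partial sums are the partial sums of the claimed series\<close>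
  have "I = (\<lambda>n. \<Sum>i<n. ellK_coeff i * x ^ i)"
    using has_integral_unique[OF I] i by auto
  moreover have "ellK (sqrt x) = J"
    using J x by (simp add: ellK_def integral_unique)
  ultimately show "(\<lambda>n. ellK_coeff n * x ^ n) sums ellK (sqrt x)"
    using \<open>I \<longlonglongrightarrow> J\<close> by (simp add: sums_def)
qed

lemma diffs_ellK_coeff_pos: "0 < diffs ellK_coeff n"
  unfolding diffs_def ellK_coeff_def by (intro mult_pos_pos) auto

text \<open>The coefficients of $(\mathcal K(\sqrt x))'$ stay below $\frac12$, those of the derivative
  of $-\frac12 \ln (1-x)$, which has the same singularity at $1$.\<close>

lemma diffs_ellK_coeff_le: "diffs ellK_coeff n \<le> 1 / 2"
  using W_sq_upper[of "Suc n"] by (simp add: diffs_def ellK_coeff_def field_simps)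

text \<open>The recursion that compares coefficients in $F' = (\mathcal K(\sqrt x))' F$ for
  $F(x) = e^{\mathcal K(\sqrt x)}$.\<close>

fun exp_ellK_coeff :: "nat \<Rightarrow> real" where
  "exp_ellK_coeff 0 = exp (pi / 2)"
| "exp_ellK_coeff (Suc n) =
    (\<Sum>k\<le>n. diffs ellK_coeff k * exp_ellK_coeff (n - k)) / (real n + 1)"

declare exp_ellK_coeff.simps(2) [simp del]

lemma exp_ellK_coeff_pos: "0 < exp_ellK_coeff n"
proof (induction n rule: less_induct)
  case (less n)
  then show ?case
    by (cases n) (auto simp: exp_ellK_coeff.simps(2) diffs_ellK_coeff_pos intro!: divide_pos_pos sum_pos mult_pos_pos)
qed

text \<open>With $\frac12$ in place of the coefficients of $(\mathcal K(\sqrt x))'$ the recursion is the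
  one satisfied by $W_n$. The bound also makes the series of $F$ converge on the unit interval.\<close>

lemma exp_ellK_coeff_le: "exp_ellK_coeff n \<le> exp (pi / 2) * W n"
proof (induction n rule: less_induct)
  case (less n)
  show ?case
  proof (cases n)
    case (Suc m)
    have "(\<Sum>k\<le>m. diffs ellK_coeff k * exp_ellK_coeff (m - k)) \<le> (\<Sum>k\<le>m. 1 / 2 * (exp (pi / 2) * W (m - k)))"
      using Suc less diffs_ellK_coeff_le diffs_ellK_coeff_pos exp_ellK_coeff_pos
      by (intro sum_mono mult_mono) (auto intro: less_imp_le)
    also have "\<dots> = 1 / 2 * exp (pi / 2) * (\<Sum>k\<le>m. W (m - k))"
      by (simp add: sum_distrib_left mult.assoc)
    also have "(\<Sum>k\<le>m. W (m - k)) = (\<Sum>k\<le>m. W k)"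
      by (rule sum.nat_diff_reindex[where n = "Suc m", unfolded lessThan_Suc_atMost diff_Suc_Suc])
    finally have "(\<Sum>k\<le>m. diffs ellK_coeff k * exp_ellK_coeff (m - k)) / (real m + 1)
        \<le> 1 / 2 * exp (pi / 2) * ((2 * real m + 1) * W m) / (real m + 1)"
      unfolding sum_W by (rule divide_right_mono) simp
    also have "\<dots> = exp (pi / 2) * W n"
      by (simp add: Suc W_Suc divide_simps)
    finally show ?thesis
      by (simp add: Suc exp_ellK_coeff.simps(2))
  qed simp
qed

text \<open>By the recursion the sum \<open>F\<close> of the series solves $F' = K' F$, so $F e^{-K}$ is constant.\<close>

lemma exp_ellK_power_series: "has_power_series (\<lambda>x. exp (ellK (sqrt x))) exp_ellK_coeff"
proof -
  define K where "K x = (\<Sum>n. ellK_coeff n * x ^ n)" for x :: real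
  define F where "F x = (\<Sum>n. exp_ellK_coeff n * x ^ n)" for x :: real
  have sK: "summable (\<lambda>n. ellK_coeff n * x ^ n)" if "\<bar>x\<bar> < 1" for x
    using has_power_series_summable[OF ellK_power_series that] .
  have sF': "summable (\<lambda>n. norm (exp_ellK_coeff n * x ^ n))" if "\<bar>x\<bar> < 1" for x :: real
  proof (rule summable_comparison_test)
    show "summable (\<lambda>n. exp (pi / 2) * (W n * \<bar>x\<bar> ^ n))"
      using W_sums[of "\<bar>x\<bar>"] that by (auto intro: sums_summable summable_mult)
    show "\<exists>N. \<forall>n\<ge>N. norm (norm (exp_ellK_coeff n * x ^ n)) \<le> exp (pi / 2) * (W n * \<bar>x\<bar> ^ n)"
      using exp_ellK_coeff_le exp_ellK_coeff_pos
      by (auto simp: abs_mult power_abs abs_of_pos mult.assoc[symmetric] intro!: mult_right_mono)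
  qed
  note sF = summable_norm_cancel[OF sF']
  have dK: "(K has_real_derivative (\<Sum>n. diffs ellK_coeff n * x ^ n)) (at x)" if "\<bar>x\<bar> < 1" for x
    unfolding K_def using that sK by (intro termdiffs_strong'[of 1]) auto
  have dF: "(F has_real_derivative (\<Sum>n. diffs exp_ellK_coeff n * x ^ n)) (at x)" if "\<bar>x\<bar> < 1" for x
    unfolding F_def using that sF by (intro termdiffs_strong'[of 1]) auto
  have ode: "(\<Sum>n. diffs exp_ellK_coeff n * x ^ n) = (\<Sum>n. diffs ellK_coeff n * x ^ n) * F x"
    if x: "\<bar>x\<bar> < 1" for x
  proof -
    have "summable (\<lambda>n. diffs ellK_coeff n * \<bar>x\<bar> ^ n)"
      using x sK by (intro termdiff_converges[of "\<bar>x\<bar>" 1]) auto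
    then have "summable (\<lambda>n. norm (diffs ellK_coeff n * x ^ n))"
      using diffs_ellK_coeff_pos by (simp add: abs_mult power_abs abs_of_pos)
    from Cauchy_product_sums[OF this sF'[OF x]]
    have "(\<lambda>n. \<Sum>k\<le>n. diffs ellK_coeff k * x ^ k * (exp_ellK_coeff (n - k) * x ^ (n - k)))
        sums ((\<Sum>n. diffs ellK_coeff n * x ^ n) * F x)"
      by (simp add: F_def)
    moreover have "(\<Sum>k\<le>n. diffs ellK_coeff k * x ^ k * (exp_ellK_coeff (n - k) * x ^ (n - k)))
        = diffs exp_ellK_coeff n * x ^ n" for n
    proof -
      have "(\<Sum>k\<le>n. diffs ellK_coeff k * x ^ k * (exp_ellK_coeff (n - k) * x ^ (n - k)))
          = (\<Sum>k\<le>n. diffs ellK_coeff k * exp_ellK_coeff (n - k)) * x ^ n"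
        unfolding sum_distrib_right
        by (intro sum.cong refl) (simp add: power_add[symmetric] ac_simps)
      then show ?thesis
        by (simp add: diffs_def[of exp_ellK_coeff] exp_ellK_coeff.simps(2) divide_simps)
    qed
    ultimately show ?thesis by (simp add: sums_iff)
  qed
  have const: "F x * exp (- K x) = 1" if x: "x \<in> {-1<..<1}" for x
  proof -
    have "(\<lambda>x. F x * exp (- K x)) constant_on {-1<..<1}"
    proof (rule has_field_derivative_0_imp_constant_on)
      fix x :: real assume "x \<in> {-1<..<1}"
      then have x: "\<bar>x\<bar> < 1" by auto
      show "((\<lambda>x. F x * exp (- K x)) has_field_derivative 0) (at x)"
        by (rule derivative_eq_intros dF[OF x] dK[OF x] refl)+ (simp add: ode[OF x])
    qed auto
    then obtain c where c: "\<And>x. x \<in> {-1<..<1} \<Longrightarrow> F x * exp (- K x) = c"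
      by (auto simp: constant_on_def)
    have "K 0 = pi / 2" "F 0 = exp (pi / 2)"
      unfolding K_def F_def powser_zero by (simp_all add: ellK_coeff_def)
    then have "F 0 * exp (- K 0) = 1"
      by (simp only: exp_minus) simp
    then have "c = 1"
      using c[of 0] by simp
    then show ?thesis using c[OF x] by simp
  qed
  show ?thesis
    unfolding has_power_series_def
  proof
    fix x :: real assume x: "x \<in> {0<..<1}"
    then have "ellK (sqrt x) = K x"
      using ellK_power_series by (auto simp: has_power_series_def K_def sums_iff)
    moreover have "F x = exp (K x)"
      using const[of x] x by (simp add: exp_minus field_simps)
    ultimately show "(\<lambda>n. exp_ellK_coeff n * x ^ n) sums exp (ellK (sqrt x))"
      using sF[of x] x by (simp add: F_def sums_iff)
  qed
qed

lemma b_eq: "b = exp_ellK_coeff"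
  unfolding b_def
proof (rule the_equality)
  show "\<forall>x\<in>{0<..<1}. (\<lambda>n. exp_ellK_coeff n * x ^ n) sums exp (ellK (sqrt x))"
    using exp_ellK_power_series by (simp add: has_power_series_def)
next
  fix c assume "\<forall>x\<in>{0<..<1}. (\<lambda>n. c n * x ^ n) sums exp (ellK (sqrt x))"
  then show "c = exp_ellK_coeff"
    using exp_ellK_power_series by (auto intro: has_power_series_unique simp: has_power_series_def)
qed

lemma b_0: "b 0 = exp (pi / 2)" by (simp add: b_eq)

lemma b_pos: "0 < b n" by (simp add: b_eq exp_ellK_coeff_pos)

lemma b_le: "b n \<le> b 0 * W n" by (simp add: b_eq exp_ellK_coeff_le)

lemma b_rec: "(real n + 1) * b (Suc n) = (\<Sum>k\<le>n. diffs ellK_coeff k * b (n - k))"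
  by (simp add: b_eq exp_ellK_coeff.simps(2))

text \<open>The recursion for the preceding index, with the sum extended to the same range by the
  vanishing term $k = 0$, so that the two can be combined termwise.\<close>

lemma b_rec': "real n * b n = (\<Sum>k\<le>n. real k * ellK_coeff k * b (n - k))"
proof (cases n)
  case (Suc m)
  have "(\<Sum>k\<le>Suc m. real k * ellK_coeff k * b (Suc m - k)) = (\<Sum>k\<le>m. diffs ellK_coeff k * b (m - k))"
    by (subst sum.atMost_Suc_shift) (simp add: diffs_def)
  then show ?thesis
    using b_rec[of m] by (simp add: Suc add.commute)
qed simp

lemma b_values:
  "b 1 = b 0 * (pi / 8)"
  "b 2 = b 0 * (pi * (pi + 9) / 128)"
  "b 3 = b 0 * (pi * (pi\<^sup>2 + 27 * pi + 150) / 3072)"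
proof -
  show 1: "b 1 = b 0 * (pi / 8)"
    using b_rec[of 0] by (simp add: diffs_def ellK_coeff_def W_Suc power2_eq_square)
  show 2: "b 2 = b 0 * (pi * (pi + 9) / 128)"
    using b_rec[of 1] 1 by (simp add: diffs_def ellK_coeff_def W_Suc power2_eq_square numeral_2_eq_2 field_simps)
  show 3: "b 3 = b 0 * (pi * (pi\<^sup>2 + 27 * pi + 150) / 3072)"
  proof -
    have "3 * b 3 = pi / 8 * b 2 + 9 * pi / 64 * b 1 + 75 * pi / 512 * b 0"
      using b_rec[of 2]
      by (simp add: diffs_def ellK_coeff_def W_Suc power2_eq_square numeral_2_eq_2 numeral_3_eq_3)
    then show ?thesis
      unfolding 1 2 by (simp add: power2_eq_square field_simps)
  qed
qed

section \<open>Monotonicity of the coefficient ratios\<close>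

text \<open>The coefficients of $C(x) = 2(1-x)\,(\mathcal K(\sqrt x))' - 1$.\<close>

definition gap_coeff :: "nat \<Rightarrow> real" where
  "gap_coeff n = pi / 4 * (W n)\<^sup>2 / (real n + 1) - (if n = 0 then 1 else 0)"

text \<open>The coefficients of $2(1-x)F' - F$ for $F(x) = e^{\mathcal K(\sqrt x)}$; the corresponding
  expression in the $W_n$ is zero, so the gap carries the sign of the increment of $b_n/W_n$.\<close>

definition gap :: "nat \<Rightarrow> real" where
  "gap n = (2 * real n + 2) * b (Suc n) - (2 * real n + 1) * b n"

lemma gap_nonneg_iff: "0 \<le> gap n \<longleftrightarrow> b n / W n \<le> b (Suc n) / W (Suc n)"
proof -
  have "b (Suc n) / W (Suc n) = (2 * real n + 2) * b (Suc n) / (2 * real n + 1) / W n"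
    by (simp add: W_Suc mult.commute)
  then show ?thesis
    by (simp add: gap_def divide_le_cancel pos_le_divide_eq mult.commute order.asym[OF W_pos])
qed

lemma gap_coeff_eq: "gap_coeff n = 2 * diffs ellK_coeff n - 2 * (real n * ellK_coeff n) - (if n = 0 then 1 else 0)"
  by (simp add: gap_coeff_def diffs_def ellK_coeff_def W_Suc_sq divide_simps)
    (simp add: power2_eq_square algebra_simps)

lemma gap_coeff_pos: "1 \<le> n \<Longrightarrow> 0 < gap_coeff n"
  by (simp add: gap_coeff_def)

lemma gap_eq_convolution: "gap n = (\<Sum>k\<le>n. gap_coeff k * b (n - k))"
proof -
  have "(\<Sum>k\<le>n. gap_coeff k * b (n - k))
      = 2 * (\<Sum>k\<le>n. diffs ellK_coeff k * b (n - k)) - 2 * (\<Sum>k\<le>n. real k * ellK_coeff k * b (n - k))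
        - (\<Sum>k\<le>n. if k = 0 then b n else 0)"
    unfolding sum_distrib_left sum_subtractf[symmetric]
    by (intro sum.cong refl) (simp add: gap_coeff_eq algebra_simps)
  then show ?thesis
    unfolding b_rec[symmetric] b_rec'[symmetric] by (simp add: gap_def algebra_simps)
qed

text \<open>A closed form of $\sum_{k > n} c_k$ for the coefficients $c_k$ of $C$, whose total sum is zero.\<close>

definition gap_tail :: "nat \<Rightarrow> real" where
  "gap_tail n = 1 - pi * (real n + 1) * (W (Suc n))\<^sup>2"

lemma sum_gap_coeff: "(\<Sum>k\<le>n. gap_coeff k) = - gap_tail n"
proof (induction n)
  case 0
  show ?case by (simp add: gap_coeff_def gap_tail_def W_Suc power2_eq_square)
next
  case (Suc n)
  have "gap_tail n - gap_tail (Suc n) = gap_coeff (Suc n)"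
    by (simp add: gap_tail_def gap_coeff_def W_Suc_sq[of "Suc n"] divide_simps)
      (simp add: power2_eq_square algebra_simps)
  then show ?case using Suc by simp
qed

lemma gap_tail_upper:
  assumes "1 - 3 * s \<le> (4 * s - 1) * (real n + 1)" "1 / 4 \<le> s"
  shows "gap_tail n \<le> s / (real n + 1 + s)"
proof -
  have "1 / (real n + 1 + s) \<le> pi * (W (Suc n))\<^sup>2"
    using W_sq_lower[of s "Suc n"] assms by (simp add: field_simps)
  from mult_left_mono[OF this, of "real n + 1"] show ?thesis
    using assms(2) by (simp add: gap_tail_def field_simps)
qed

lemma gap_small: "0 \<le> gap 1" "0 \<le> gap 2" "0 \<le> gap 3"
proof -
  have c: "gap_coeff 0 = pi / 4 - 1" "gap_coeff 1 = pi / 32" "gap_coeff 2 = 3 * pi / 256"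
    "gap_coeff 3 = 25 * pi / 4096"
    by (simp_all add: gap_coeff_def W_Suc eval_nat_numeral power2_eq_square)
  have "gap 1 = gap_coeff 0 * b 1 + gap_coeff 1 * b 0"
    by (simp add: gap_eq_convolution)
  then have g1: "gap 1 = b 0 * pi * (pi - 3) / 32"
    unfolding c b_values by (simp add: field_simps)
  show "0 \<le> gap 1"
    unfolding g1 using pi_gt3 b_pos[of 0] by simp
  have "gap 2 = gap_coeff 0 * b 2 + gap_coeff 1 * b 1 + gap_coeff 2 * b 0"
    by (simp add: gap_eq_convolution numeral_2_eq_2)
  then have g2: "gap 2 = b 0 * pi * ((pi - 3) * (pi + 10)) / 512"
    unfolding c b_values by (simp add: field_simps)
  show "0 \<le> gap 2"
    unfolding g2 using pi_gt3 b_pos[of 0] by simp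
  have "gap 3 = gap_coeff 0 * b 3 + gap_coeff 1 * b 2 + gap_coeff 2 * b 1 + gap_coeff 3 * b 0"
    by (simp add: gap_eq_convolution numeral_2_eq_2 numeral_3_eq_3)
  then have g3: "gap 3 = b 0 * pi * (pi ^ 3 + 26 * pi\<^sup>2 + 87 * pi - 525) / 12288"
    unfolding c b_values by (simp add: power2_eq_square power3_eq_cube field_simps)
  have "(31/10) ^ 3 \<le> pi ^ 3" "(31/10)\<^sup>2 \<le> pi\<^sup>2"
    using pi_approx(1) by (intro power_mono; simp)+
  then have "0 \<le> pi ^ 3 + 26 * pi\<^sup>2 + 87 * pi - 525"
    using pi_approx(1) by (simp add: power2_eq_square power3_eq_cube)
  then show "0 \<le> gap 3"
    unfolding g3 using b_pos[of 0] by simp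
qed

text \<open>The first coefficient contributes $(\frac{\pi}{4} - 1) b_j$, so the convolution over
  $k \ge 1$ must be at most $b_j/2$. The growing ratios bound $b_{j-k}$ by $\frac{4}{\pi} \beta_j W_{j-k}$ with
  $\beta_j = b_j/W_j$; the factor $\frac{4}{\pi}$ cannot be dropped because of the exceptional ratio
  $\beta_0 = \frac{4}{\pi} \beta_1$, and it cancels the factor $\frac{\pi}{4}$ of $c_k$.\<close>

lemma gap_upper:
  assumes "1 \<le> j" and mono: "\<And>i. 1 \<le> i \<Longrightarrow> i < j \<Longrightarrow> 0 \<le> gap i"
  shows "gap j \<le> (pi / 4 - 1 / 2) * b j"
proof -
  \<comment> \<open>the ratios up to index \<open>j\<close> increase, by the hypothesis\<close>
  define r where "r i = b i / W i" for i
  have r: "r i \<le> r j" if "1 \<le> i" "i \<le> j" for i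
    using that(2,1)
  proof (induction rule: inc_induct)
    case (step i)
    then show ?case
      using mono[of i] unfolding gap_nonneg_iff r_def by fastforce
  qed simp
  have r_pos: "0 < r j" by (simp add: r_def b_pos)
  have bound: "b i \<le> 4 / pi * r j * W i" if "i < j" for i
  proof (cases i)
    case 0
    have "r 1 = 2 * b 1" by (simp add: r_def W_Suc)
    then have "b 0 = 4 / pi * r 1"
      unfolding b_values by (simp only:) simp
    also have "\<dots> \<le> 4 / pi * r j"
      using r[of 1] assms(1) by (intro mult_left_mono) auto
    finally show ?thesis by (simp add: 0)
  next
    case (Suc k)
    have "1 * r j \<le> 4 / pi * r j"
      using pi_less_4 r_pos by (intro mult_right_mono) (auto simp: field_simps)
    then have "r i \<le> 4 / pi * r j"
      using r[of i] Suc that by simp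
    from mult_right_mono[OF this, of "W i"] show ?thesis
      by (simp add: r_def less_imp_le)
  qed
  have "gap j = (pi / 4 - 1) * b j + (\<Sum>k=1..j. gap_coeff k * b (j - k))"
    unfolding gap_eq_convolution
    by (simp add: atLeast0AtMost[symmetric] sum.atLeast_Suc_atMost gap_coeff_def[of 0])
  also have "(\<Sum>k=1..j. gap_coeff k * b (j - k)) \<le> (\<Sum>k=1..j. gap_coeff k * (4 / pi * r j * W (j - k)))"
    using gap_coeff_pos bound by (intro sum_mono mult_left_mono) (auto intro: less_imp_le)
  also have "\<dots> = r j * (\<Sum>k=1..j. (W k)\<^sup>2 * W (j - k) / (real k + 1))"
    unfolding sum_distrib_left by (intro sum.cong refl) (simp add: gap_coeff_def divide_simps)
  also have "\<dots> \<le> r j * (W j / 2)"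
    using r_pos by (intro mult_left_mono W_square_convolution_le) auto
  also have "r j * (W j / 2) = b j / 2"
    by (simp add: r_def)
  finally show ?thesis by (simp add: algebra_simps)
qed

text \<open>The left side bounds $n \tau_n$ from above and tends to $\frac{53}{200}$, slightly more than the
  limit $\frac14$ of $n \tau_n$, while the sum on the right grows logarithmically. For moderate $n$
  that sum is too small, and the second term, of order $n^{-1/2}$, makes up for it. The induction
  step compares the increments of both sides.\<close>

lemma weighted_gap_coeff_bound:
  assumes "4 \<le> n"
  shows "53/200 * real n / (real n + 253/200)
      \<le> 7/20 * (\<Sum>k<n. real k * gap_coeff k) + real n * gap_coeff n * (1 / W n - 1)"
  using assms
proof (induction n rule: dec_induct)
  case base
  show ?case
    using pi_approx(1) by (simp add: gap_coeff_def W_Suc eval_nat_numeral power2_eq_square field_simps)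
next
  case (step n)
  define N where "N = real n"
  define w where "w = W n"
  have N: "4 \<le> N" using step by (simp add: N_def)
  have w: "0 < w" by (simp add: w_def)
  have W': "W (Suc n) = w * (2 * N + 1) / (2 * N + 2)"
    by (simp add: W_Suc w_def N_def)
  \<comment> \<open>\<open>Q\<close> is \<open>16 (N + 1) (N + 2) / pi\<close> times the increment of the right side, written in \<open>w\<close>\<close>
  define Q where "Q = 7/5 * w\<^sup>2 * N * (N + 2) - 2 * (N - 1) * w + (4 * N - 1) * w\<^sup>2"
  \<comment> \<open>the shift \<open>28/100\<close> is admissible in \<open>W_sq_lower\<close> from index 2 on\<close>
  have "1 / pi \<le> (N + 28/100) * w\<^sup>2"
    using W_sq_lower[of "28/100" n] N by (simp add: N_def w_def)
  then have low: "1 / (N + 28/100) \<le> pi * w\<^sup>2"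
    using N by (simp add: field_simps)
  \<comment> \<open>the term linear in \<open>w\<close> is the only negative one; completing the square leaves, up to
    a constant, only \<open>w\<^sup>2\<close>, for which the lower bound applies\<close>
  have "2 * (N - 1) * w \<le> (N - 1)\<^sup>2 * w\<^sup>2 + 1"
    using zero_le_power2[of "(N - 1) * w - 1"] by (simp add: power2_eq_square algebra_simps)
  then have Q: "(2/5 * N\<^sup>2 + 44/5 * N - 2) * w\<^sup>2 - 1 \<le> Q"
    by (simp add: Q_def power2_eq_square field_simps)
  have "253/200 * (53/200) * 16 + 63/20 \<le> (2/5 * N\<^sup>2 + 44/5 * N - 2) * (1 / (N + 28/100))"
    using N mult_mono[OF N N] by (simp add: power2_eq_square field_simps)
  also have "\<dots> \<le> (2/5 * N\<^sup>2 + 44/5 * N - 2) * (pi * w\<^sup>2)"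
    using N by (intro mult_left_mono low) (simp add: add_increasing)
  also have "\<dots> \<le> pi * Q + pi"
    using mult_left_mono[OF Q, of pi] by (simp add: algebra_simps)
  finally have main: "253/200 * (53/200) * 16 \<le> pi * Q"
    using pi_approx(2) by simp
  have "53/200 * (N + 1) / (N + 1 + 253/200) - 53/200 * N / (N + 253/200)
      = 53/200 * (253/200) / ((N + 253/200) * (N + 453/200))"
    using N by (simp add: divide_simps) (simp add: algebra_simps)
  also have "\<dots> \<le> 53/200 * (253/200) / ((N + 1) * (N + 2))"
    using N by (intro divide_left_mono mult_mono mult_pos_pos) auto
  also have "\<dots> \<le> pi * Q / 16 / ((N + 1) * (N + 2))"
    using main N by (intro divide_right_mono) auto
  also have "\<dots> = 7/20 * (N * gap_coeff n) + (N + 1) * gap_coeff (Suc n) * (1 / W (Suc n) - 1)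
      - N * gap_coeff n * (1 / W n - 1)"
    using N w step
    by (simp add: Q_def gap_coeff_def W' flip: N_def w_def) (simp add: divide_simps, simp add: power2_eq_square algebra_simps)
  finally show ?case
    using step.IH by (simp add: N_def algebra_simps)
qed

text \<open>Strong induction on $n$. For $n \ge 4$ the hypothesis gives, through \<open>gap_upper\<close>, the decrease of $b$
  up to index $n$, and this is inserted in $g_n = \sum_{k=1}^n c_k (b_{n-k} - b_n) - \tau_n b_n$.\<close>

lemma gap_nonneg:
  assumes "1 \<le> n"
  shows "0 \<le> gap n"
  using assms
proof (induction n rule: less_induct)
  case (less n)
  consider "n = 1" | "n = 2" | "n = 3" | "4 \<le> n" using less.prems by linarith
  then show ?case
  proof cases
    case 4
    \<comment> \<open>the constant \<open>7/20\<close> is half of \<open>1 - 3/10\<close>, where \<open>3/10\<close> replaces \<open>pi/4 - 1/2\<close>\<close>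
    have drop: "7/20 * (b i / (real i + 1)) \<le> b i - b (Suc i)" if "1 \<le> i" "i < n" for i
    proof -
      have "gap i \<le> (pi / 4 - 1 / 2) * b i"
        using that less by (intro gap_upper) auto
      also have "\<dots> \<le> (3 / 10) * b i"
        using pi_approx(2) b_pos[of i] by (intro mult_right_mono) auto
      finally show ?thesis
        by (simp add: gap_def field_simps)
    qed
    have anti: "b n \<le> b i" if "1 \<le> i" "i \<le> n" for i
      using that(2,1)
    proof (induction rule: inc_induct)
      case (step i)
      have "0 \<le> 7/20 * (b i / (real i + 1))" using b_pos[of i] by simp
      then show ?case using step drop[of i] by linarith
    qed simp
    have lower: "7/20 * real k / real n * b n \<le> b (n - k) - b n" if "k < n" for k
      using that
    proof (induction k)
      case (Suc k)
      define i where "i = n - Suc k"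
      have i: "1 \<le> i" "i < n" "Suc i = n - k" using Suc.prems by (auto simp: i_def)
      have "b n / real n \<le> b i / (real i + 1)"
        using anti[of i] i b_pos[of n] b_pos[of i] by (intro frac_le) (auto intro: less_imp_le)
      then have "7/20 * (b n / real n) \<le> 7/20 * (b i / (real i + 1))"
        by (rule mult_left_mono) simp
      also have "\<dots> \<le> b i - b (Suc i)"
        using drop[OF i(1,2)] .
      finally have "7/20 / real n * b n \<le> b i - b (Suc i)" by simp
      moreover have "7/20 * real (Suc k) / real n * b n = 7/20 * real k / real n * b n + 7/20 / real n * b n"
        by (simp add: add_divide_distrib distrib_left distrib_right)
      ultimately show ?case using Suc i by (simp add: i_def)
    qed simp
    have "b n / W n \<le> b 0"
      using b_le[of n] by (simp add: field_simps)
    then have last: "b n * (1 / W n - 1) \<le> b 0 - b n"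
      by (simp add: algebra_simps)
    \<comment> \<open>the shift \<open>53/200\<close> is close to \<open>1/4\<close>, yet admissible for every index from 4 on\<close>
    have "gap_tail n \<le> (53/200) / (real n + 253/200)"
      using gap_tail_upper[of "53/200" n] 4 by (simp add: add.commute)
    then have "real n * gap_tail n \<le> real n * ((53/200) / (real n + 253/200))"
      by (rule mult_left_mono) simp
    also have "\<dots> = 53/200 * real n / (real n + 253/200)" by simp
    also note weighted_gap_coeff_bound[OF 4]
    finally have "0 \<le> b n / real n * (7/20 * (\<Sum>k<n. real k * gap_coeff k)
        + real n * gap_coeff n * (1 / W n - 1) - real n * gap_tail n)"
      using b_pos[of n] by simp
    also have "\<dots> = (\<Sum>k<n. gap_coeff k * (7/20 * real k / real n * b n))
        + gap_coeff n * (b n * (1 / W n - 1)) - gap_tail n * b n"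
    proof -
      have "(\<Sum>k<n. gap_coeff k * (7/20 * real k / real n * b n)) = b n / real n * (7/20 * (\<Sum>k<n. real k * gap_coeff k))"
        unfolding sum_distrib_left by (intro sum.cong refl) (simp add: mult_ac)
      then show ?thesis
        using 4 by (simp add: algebra_simps)
    qed
    also have "\<dots> \<le> (\<Sum>k<n. gap_coeff k * (b (n - k) - b n)) + gap_coeff n * (b 0 - b n) - gap_tail n * b n"
    proof (intro diff_right_mono add_mono sum_mono)
      fix k assume "k \<in> {..<n}"
      then show "gap_coeff k * (7/20 * real k / real n * b n) \<le> gap_coeff k * (b (n - k) - b n)"
        using mult_left_mono[OF lower[of k], of "gap_coeff k"] gap_coeff_pos[of k] by (cases "k = 0") auto
    qed (use last gap_coeff_pos[of n] 4 in auto)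
    also have "\<dots> = (\<Sum>k\<le>n. gap_coeff k * (b (n - k) - b n)) - gap_tail n * b n"
      by (simp add: lessThan_Suc_atMost[symmetric])
    also have "\<dots> = gap n - ((\<Sum>k\<le>n. gap_coeff k) + gap_tail n) * b n"
      unfolding gap_eq_convolution by (simp add: sum_subtractf sum_distrib_left algebra_simps)
    also have "\<dots> = gap n"
      by (simp add: sum_gap_coeff)
    finally show ?thesis .
  qed (use gap_small in auto)
qed

lemma ratio_mono:
  assumes "1 \<le> m" "m \<le> n"
  shows "b m / W m \<le> b n / W n"
  using assms(2)
proof (induction rule: dec_induct)
  case (step n)
  then show ?case using gap_nonneg[of n] assms(1) by (simp add: gap_nonneg_iff)
qed simp

section \<open>Logarithmic behaviour of the elliptic integral at the right end point\<close>

text \<open>The reflection $t \mapsto \pi/2 - t$ moves the near-singularity to $t = 0$.\<close>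

lemma ellK_complementary:
  assumes "0 < x" "x < 1"
  shows "((\<lambda>t. 1 / sqrt (1 - x * (cos t)\<^sup>2)) has_integral ellK (sqrt x)) {0..pi/2}"
proof -
  let ?f = "\<lambda>t. 1 / sqrt (1 - x * (sin t)\<^sup>2)"
  have pos: "0 < 1 - x * (sin t)\<^sup>2" for t
  proof -
    have "x * (sin t)\<^sup>2 \<le> x" using assms by (simp add: abs_square_le_1 mult_left_le)
    then show ?thesis using assms by linarith
  qed
  have "?f integrable_on {0..pi/2}"
    using pos by (intro integrable_continuous_real continuous_intros) (auto simp: less_imp_neq[symmetric] simp del: right_diff_distrib)
  then have "(?f has_integral ellK (sqrt x)) {0..pi/2}"
    using assms by (simp add: ellK_def integrable_integral)
  from has_integral_affinity[OF this[folded cbox_interval], of "-1" "pi/2"]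
  show ?thesis
    by (simp add: sin_diff image_affinity_cbox)
qed

text \<open>The part of the integral that carries the logarithm. The primitive is
  $\frac1r \ln (r \sin t + \sqrt{k^2 + r^2 \sin^2 t})$ with $r = \sqrt{1-k^2}$.\<close>

lemma integral_cos_over_sqrt:
  assumes "0 < k" "k < 1"
  shows "((\<lambda>t. cos t / sqrt (k\<^sup>2 + (1 - k\<^sup>2) * (sin t)\<^sup>2)) has_integral
      ln ((1 + sqrt (1 - k\<^sup>2)) / k) / sqrt (1 - k\<^sup>2)) {0..pi/2}"
proof -
  define r where "r = sqrt (1 - k\<^sup>2)"
  have k2: "k\<^sup>2 < 1" using assms by (simp add: power_less_one_iff)
  then have r: "0 < r" "r\<^sup>2 = 1 - k\<^sup>2" by (auto simp: r_def)
  define q where "q t = k\<^sup>2 + r\<^sup>2 * (sin t)\<^sup>2" for t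
  define h where "h t = r * sin t + sqrt (q t)" for t
  have "((\<lambda>t. ln (h t) / r) has_vector_derivative cos t / sqrt (q t)) (at t within {0..pi/2})"
    if t: "t \<in> {0..pi/2}" for t
  proof -
    define S where "S = sqrt (q t)"
    have q: "0 < q t" using assms by (auto simp: q_def intro!: add_pos_nonneg)
    then have S: "0 < S" by (simp add: S_def)
    have "0 \<le> sin t" using t by (intro sin_ge_zero) auto
    then have h: "0 < h t" using S r by (auto simp: h_def S_def intro!: add_nonneg_pos)
    have dq: "(q has_real_derivative r\<^sup>2 * (2 * sin t * cos t)) (at t within {0..pi/2})"
      unfolding q_def by (rule derivative_eq_intros refl)+ simp
    have dS: "((\<lambda>t. sqrt (q t)) has_real_derivative inverse S / 2 * (r\<^sup>2 * (2 * sin t * cos t))) (at t within {0..pi/2})"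
      unfolding S_def by (rule DERIV_chain2[where f = sqrt and g = q, OF DERIV_real_sqrt[OF q] dq])
    have dh: "(h has_real_derivative r * cos t + inverse S / 2 * (r\<^sup>2 * (2 * sin t * cos t))) (at t within {0..pi/2})"
      unfolding h_def by (rule DERIV_add[OF DERIV_cmult[OF has_field_derivative_at_within[OF DERIV_sin]] dS])
    have "((\<lambda>t. ln (h t) / r) has_real_derivative
        1 / h t * (r * cos t + inverse S / 2 * (r\<^sup>2 * (2 * sin t * cos t))) / r) (at t within {0..pi/2})"
      by (rule DERIV_cdivide[OF DERIV_chain2[where f = ln and g = h, OF DERIV_ln_divide[OF h] dh]])
    also have "r * cos t + inverse S / 2 * (r\<^sup>2 * (2 * sin t * cos t)) = h t * (r * cos t / S)"
      unfolding h_def S_def[symmetric] using S by (simp add: field_simps power2_eq_square)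
    also have "1 / h t * (h t * (r * cos t / S)) / r = cos t / S"
      using h r by simp
    finally show ?thesis by (simp add: has_real_derivative_iff_has_vector_derivative S_def)
  qed
  then have "((\<lambda>t. cos t / sqrt (q t)) has_integral (ln (h (pi/2)) / r - ln (h 0) / r)) {0..pi/2}"
    by (intro fundamental_theorem_of_calculus) auto
  moreover have "ln (h (pi/2)) / r - ln (h 0) / r = ln ((1 + r) / k) / r"
    using assms r by (simp add: h_def q_def ln_div diff_divide_distrib add.commute)
  ultimately show ?thesis
    unfolding q_def r(2) unfolding r_def by simp
qed

lemma has_integral_tan_half: "((\<lambda>t. tan (t / 2)) has_integral ln 2) {0..pi/2}"
proof -
  have "((\<lambda>t. - 2 * ln (cos (t / 2))) has_vector_derivative tan (t / 2)) (at t within {0..pi/2})"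
    if "t \<in> {0..pi/2}" for t
  proof -
    have "0 < cos (t / 2)" using that pi_gt_zero by (intro cos_gt_zero_pi; simp add: field_simps; linarith)
    then have "((\<lambda>t. - 2 * ln (cos (t / 2))) has_real_derivative tan (t / 2)) (at t within {0..pi/2})"
      by (auto intro!: derivative_eq_intros simp: tan_def)
    then show ?thesis by (simp add: has_real_derivative_iff_has_vector_derivative)
  qed
  then have "((\<lambda>t. tan (t / 2)) has_integral (- 2 * ln (cos (pi / 2 / 2)) - - 2 * ln (cos (0 / 2)))) {0..pi/2}"
    by (intro fundamental_theorem_of_calculus) auto
  moreover have "- 2 * ln (cos (pi / 2 / 2)) - - 2 * ln (cos (0 / 2)) = ln 2"
    by (simp add: cos_45 ln_div ln_sqrt)
  ultimately show ?thesis by simp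
qed

lemma tan_half_eq: "0 < sin t \<Longrightarrow> (1 - cos t) / sin t = tan (t / 2)" for t :: real
proof -
  assume s: "0 < sin t"
  have "(1 - cos t) * (cos t + 1) = sin t * sin t"
    using sin_cos_squared_add[of t] by (simp add: power2_eq_square algebra_simps)
  moreover have "cos t + 1 \<noteq> 0"
  proof
    assume "cos t + 1 = 0"
    then have "cos t = -1" by simp
    with s show False using sin_cos_squared_add[of t] by simp
  qed
  ultimately show ?thesis
    using s by (simp add: tan_half field_simps)
qed

text \<open>The factor $1 - \cos t$ removes the singularity that appears at $t = 0$ when $k \to 0$:
  the integrands are dominated by their limit $(1 - \cos t)/\sin t = \tan (t/2)$.\<close>

lemma one_minus_cos_integral_limit:
  assumes "k \<longlonglongrightarrow> 0" "\<And>n. 0 < k n" "\<And>n. k n < 1"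
  shows "(\<lambda>n. integral {0..pi/2} (\<lambda>t. (1 - cos t) / sqrt ((k n)\<^sup>2 + (1 - (k n)\<^sup>2) * (sin t)\<^sup>2))) \<longlonglongrightarrow> ln 2"
proof -
  have rad: "(sin t)\<^sup>2 \<le> (k n)\<^sup>2 + (1 - (k n)\<^sup>2) * (sin t)\<^sup>2" "0 < (k n)\<^sup>2 + (1 - (k n)\<^sup>2) * (sin t)\<^sup>2" for n and t :: real
  proof -
    have "0 \<le> (k n)\<^sup>2 * (1 - (sin t)\<^sup>2)"
      by (simp add: abs_square_le_1)
    then show "(sin t)\<^sup>2 \<le> (k n)\<^sup>2 + (1 - (k n)\<^sup>2) * (sin t)\<^sup>2"
      by (simp add: algebra_simps)
    have "(k n)\<^sup>2 < 1" using assms(2,3)[of n] by (simp add: power_less_one_iff)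
    then show "0 < (k n)\<^sup>2 + (1 - (k n)\<^sup>2) * (sin t)\<^sup>2"
      using assms(2)[of n] by (intro add_pos_nonneg mult_nonneg_nonneg) auto
  qed
  have "(\<lambda>n. integral {0..pi/2} (\<lambda>t. (1 - cos t) / sqrt ((k n)\<^sup>2 + (1 - (k n)\<^sup>2) * (sin t)\<^sup>2)))
      \<longlonglongrightarrow> integral {0..pi/2} (\<lambda>t. tan (t / 2))"
  proof (rule dominated_convergence(2))
    show "(\<lambda>t. (1 - cos t) / sqrt ((k n)\<^sup>2 + (1 - (k n)\<^sup>2) * (sin t)\<^sup>2)) integrable_on {0..pi/2}" for n
      using rad(2)[where n = n] by (intro integrable_continuous_real continuous_intros) (auto simp: less_imp_neq[symmetric])
    show "(\<lambda>t. tan (t / 2)) integrable_on {0..pi/2}"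
      using has_integral_tan_half by blast
    fix t :: real assume t: "t \<in> {0..pi/2}"
    show "norm ((1 - cos t) / sqrt ((k n)\<^sup>2 + (1 - (k n)\<^sup>2) * (sin t)\<^sup>2)) \<le> tan (t / 2)" for n
    \<comment> \<open>at \<open>t = 0\<close> both sides are \<open>0\<close>, since \<open>1 - cos 0 = 0\<close>\<close>
    proof (cases "t = 0")
      case False
      then have s: "0 < sin t" using t by (intro sin_gt_zero) auto
      have "(1 - cos t) / sqrt ((k n)\<^sup>2 + (1 - (k n)\<^sup>2) * (sin t)\<^sup>2) \<le> (1 - cos t) / sin t"
        using rad[where n = n and t = t] s by (intro divide_left_mono mult_pos_pos) (auto intro: real_le_rsqrt)
      then show ?thesis
        using rad(2)[where n = n and t = t] s by (simp add: tan_half_eq)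
    qed simp
    show "(\<lambda>n. (1 - cos t) / sqrt ((k n)\<^sup>2 + (1 - (k n)\<^sup>2) * (sin t)\<^sup>2)) \<longlonglongrightarrow> tan (t / 2)"
    proof (cases "t = 0")
      case False
      then have s: "0 < sin t" using t by (intro sin_gt_zero) auto
      have "(\<lambda>n. (1 - cos t) / sqrt ((k n)\<^sup>2 + (1 - (k n)\<^sup>2) * (sin t)\<^sup>2)) \<longlonglongrightarrow>
          (1 - cos t) / sqrt (0\<^sup>2 + (1 - 0\<^sup>2) * (sin t)\<^sup>2)"
        using s by (intro tendsto_intros assms(1)) auto
      then show ?thesis using s by (simp add: tan_half_eq)
    qed simp
  qed
  then show ?thesis using has_integral_tan_half by (simp add: integral_unique)
qed

text \<open>Splitting $1 = (1 - \cos t) + \cos t$ in the integrand writes $\mathcal K(r)$ as a term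
  tending to $\ln 2$ plus $\frac1r \ln ((1+r)/k)$, where $k = \sqrt{1-r^2}$; as $r \to 1$ this is
  $\ln (4/k) + o(1)$.\<close>

lemma exp_ellK_asymptotic:
  assumes "k \<longlonglongrightarrow> 0" "\<And>n. 0 < k n" "\<And>n. k n < 1"
  shows "(\<lambda>n. k n * exp (ellK (sqrt (1 - (k n)\<^sup>2)))) \<longlonglongrightarrow> 4"
proof -
  define I where "I n = integral {0..pi/2} (\<lambda>t. (1 - cos t) / sqrt ((k n)\<^sup>2 + (1 - (k n)\<^sup>2) * (sin t)\<^sup>2))" for n
  define r where "r n = sqrt (1 - (k n)\<^sup>2)" for n
  have k2: "(k n)\<^sup>2 < 1" "0 < (k n)\<^sup>2" for n using assms(2,3)[of n] by (simp_all add: power_less_one_iff)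
  have eq: "ellK (r n) = I n + ln ((1 + r n) / k n) / r n" for n
  proof -
    have "1 - (1 - (k n)\<^sup>2) * (cos t)\<^sup>2 = (k n)\<^sup>2 + (1 - (k n)\<^sup>2) * (sin t)\<^sup>2" for t
      by (simp add: cos_squared_eq algebra_simps)
    then have K: "((\<lambda>t. 1 / sqrt ((k n)\<^sup>2 + (1 - (k n)\<^sup>2) * (sin t)\<^sup>2)) has_integral ellK (r n)) {0..pi/2}"
      using ellK_complementary[of "1 - (k n)\<^sup>2"] k2[of n] by (simp add: r_def)
    have "((\<lambda>t. (1 - cos t) / sqrt ((k n)\<^sup>2 + (1 - (k n)\<^sup>2) * (sin t)\<^sup>2)) has_integral
        (ellK (r n) - ln ((1 + r n) / k n) / r n)) {0..pi/2}"
      using has_integral_diff[OF K integral_cos_over_sqrt[OF assms(2,3)]]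
      by (simp add: r_def diff_divide_distrib)
    then show ?thesis by (simp add: I_def integral_unique)
  qed
  have r_lim: "r \<longlonglongrightarrow> 1"
    unfolding r_def by (rule tendsto_eq_intros assms(1) refl | simp)+
  \<comment> \<open>the factor \<open>k\<close> cancels \<open>exp (- ln k / r)\<close> up to the last exponential, because
    \<open>1 / r - 1 = k\<^sup>2 / (r * (1 + r))\<close>\<close>
  have "(\<lambda>n. k n * exp (ellK (r n))) = (\<lambda>n. exp (I n) * exp (ln (1 + r n) / r n) * exp (- (k n * ln (k n)) * (k n / (r n * (1 + r n)))))"
  proof
    fix n
    have rn: "0 < r n" "(r n)\<^sup>2 = 1 - (k n)\<^sup>2" using k2[of n] by (auto simp: r_def)
    have "1 / r n = 1 + (k n)\<^sup>2 / (r n * (1 + r n))"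
      using rn by (simp add: divide_simps) (simp add: power2_eq_square algebra_simps)
    then have "ln (k n) / r n = ln (k n) + k n * ln (k n) * (k n / (r n * (1 + r n)))"
      by (metis (no_types, opaque_lifting) times_divide_eq_right mult.right_neutral distrib_left
          power2_eq_square mult.assoc mult.commute)
    then have "ellK (r n) = I n + ln (1 + r n) / r n - ln (k n) + - (k n * ln (k n)) * (k n / (r n * (1 + r n)))"
      using assms(2)[of n] rn by (simp add: eq ln_div diff_divide_distrib)
    then show "k n * exp (ellK (r n)) = exp (I n) * exp (ln (1 + r n) / r n) * exp (- (k n * ln (k n)) * (k n / (r n * (1 + r n))))"
      using assms(2)[of n] by (simp only: exp_add exp_diff exp_ln) simp
  qed
  moreover have "I \<longlonglongrightarrow> ln 2"
    unfolding I_def by (rule one_minus_cos_integral_limit[OF assms])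
  moreover have "(\<lambda>n. k n * ln (k n)) \<longlonglongrightarrow> 0"
  proof (rule filterlim_compose[of "\<lambda>x. x * ln x" _ "at_right 0"])
    show "((\<lambda>x::real. x * ln x) \<longlongrightarrow> 0) (at_right 0)"
      by real_asymp
    show "filterlim k (at_right 0) sequentially"
      using assms(1) less_imp_neq[OF assms(2)] assms(2) by (auto simp: filterlim_at intro!: always_eventually)
  qed
  ultimately have "(\<lambda>n. k n * exp (ellK (r n))) \<longlonglongrightarrow>
      exp (ln 2) * exp (ln (1 + 1) / 1) * exp (- 0 * (0 / (1 * (1 + 1))))"
    by (simp only:) (intro tendsto_intros r_lim assms(1); simp)
  then show ?thesis by (simp add: r_def)
qed

section \<open>Bounds for the coefficient ratios and the characterisation\<close>

lemma G_power_series: "has_power_series (G p) (\<lambda>n. b n - p * W n)"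
  unfolding has_power_series_def
proof
  fix x :: real assume x: "x \<in> {0<..<1}"
  have "(\<lambda>n. b n * x ^ n) sums exp (ellK (sqrt x))"
    using exp_ellK_power_series x by (simp add: b_eq has_power_series_def)
  moreover have "(\<lambda>n. p * (W n * x ^ n)) sums (p * (1 / sqrt (1 - x)))"
    using x by (intro sums_mult W_sums) auto
  ultimately have "(\<lambda>n. b n * x ^ n - p * (W n * x ^ n)) sums (exp (ellK (sqrt x)) - p * (1 / sqrt (1 - x)))"
    by (rule sums_diff)
  then show "(\<lambda>n. (b n - p * W n) * x ^ n) sums G p x"
    by (simp add: G_def algebra_simps)
qed

text \<open>If $b_n - pW_n$ has constant sign for large $n$, then $\mathcal G_p$ is bounded on one side,
  so the limit $4 - p$ of $\sqrt{1-x}\,\mathcal G_p(x)$ at $1$ has that sign.\<close>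

lemma eventual_ratio_bounds:
  shows "(\<And>n. m \<le> n \<Longrightarrow> b n \<le> p * W n) \<Longrightarrow> 4 \<le> p"
    and "(\<And>n. m \<le> n \<Longrightarrow> p * W n \<le> b n) \<Longrightarrow> p \<le> 4"
proof -
  define k where "k n = 1 / (real n + 2)" for n
  have k: "k \<longlonglongrightarrow> 0" "\<And>n. 0 < k n" "\<And>n. k n < 1"
    unfolding k_def by real_asymp (auto simp: field_simps)
  have x: "1 - (k n)\<^sup>2 \<in> {0<..<1}" for n
    using k(2,3)[of n] by (simp add: power_less_one_iff)
  have G: "k n * G p (1 - (k n)\<^sup>2) = k n * exp (ellK (sqrt (1 - (k n)\<^sup>2))) - p" for n
    using k(2)[of n] by (simp add: G_def algebra_simps)
  have lim: "(\<lambda>n. k n * G p (1 - (k n)\<^sup>2)) \<longlonglongrightarrow> 4 - p"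
    unfolding G by (intro tendsto_intros exp_ellK_asymptotic k)
  have lim0: "(\<lambda>n. k n * c) \<longlonglongrightarrow> 0" for c
    using tendsto_mult_left_zero[OF k(1)] .
  show "4 \<le> p" if *: "\<And>n. m \<le> n \<Longrightarrow> b n \<le> p * W n"
  proof -
    obtain M where M: "\<And>x. x \<in> {0<..<1} \<Longrightarrow> - M \<le> - G p x"
      by (rule bounded_below_if_coeffs_eventually_nonneg[OF has_power_series_uminus[OF G_power_series], of m p])
        (use * in auto)
    have "k n * G p (1 - (k n)\<^sup>2) \<le> k n * M" for n
      using M[OF x[of n]] k(2)[of n] by (intro mult_left_mono) auto
    from LIMSEQ_le[OF lim lim0[of M]] this show ?thesis by auto
  qed
  show "p \<le> 4" if *: "\<And>n. m \<le> n \<Longrightarrow> p * W n \<le> b n"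
  proof -
    obtain M where M: "\<And>x. x \<in> {0<..<1} \<Longrightarrow> - M \<le> G p x"
      by (rule bounded_below_if_coeffs_eventually_nonneg[OF G_power_series, of m p]) (use * in auto)
    have "k n * (- M) \<le> k n * G p (1 - (k n)\<^sup>2)" for n
      using M[OF x[of n]] k(2)[of n] by (intro mult_left_mono) auto
    from LIMSEQ_le[OF lim0[of "- M"] lim] this show ?thesis by auto
  qed
qed

text \<open>By monotonicity each ratio is a lower bound for all later ones.\<close>

lemma ratio_le_4:
  assumes "1 \<le> n"
  shows "b n / W n \<le> 4"
proof (rule eventual_ratio_bounds(2))
  fix j assume "n \<le> j"
  from ratio_mono[OF assms this] show "b n / W n * W j \<le> b j"
    by (simp add: pos_le_divide_eq)
qed

text \<open>Ten terms of the exponential series at rational points just below and just above $\pi/2$.\<close>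

lemma pi_exp_bounds: "3.778 \<le> pi * exp (pi/2) / 4" "pi * exp (pi/2) / 4 < 3.779"
proof -
  define l :: real where "l = 157079/100000"
  define u :: real where "u = 15708/10000"
  obtain t where t: "exp l = (\<Sum>m<10. l ^ m / fact m) + exp t / fact 10 * l ^ 10"
    using Maclaurin_exp_le[of l 10] by auto
  have "(48104/10000 :: real) \<le> (\<Sum>m<10. l ^ m / fact m)"
    by (simp add: l_def lessThan_nat_numeral fact_numeral power_divide)
  also have "\<dots> \<le> exp l"
    unfolding t by (simp add: l_def)
  also have "\<dots> \<le> exp (pi / 2)"
    using pi_approx(1) by (simp add: l_def)
  finally have "314158/100000 * (48104/10000) \<le> pi * exp (pi / 2)"
    using pi_approx(1) by (intro mult_mono) auto
  then show "3.778 \<le> pi * exp (pi/2) / 4" by simp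
  \<comment> \<open>the remainder is at most \<open>exp u * e\<close>; solving for \<open>exp u\<close> bounds it by the partial sum\<close>
  define e where "e = u ^ 10 / fact 10"
  obtain t where t: "\<bar>t\<bar> \<le> u" "exp u = (\<Sum>m<10. u ^ m / fact m) + exp t * e"
    using Maclaurin_exp_le[of u 10] by (auto simp: u_def e_def)
  have "exp t * e \<le> exp u * e"
    using t(1) by (intro mult_right_mono) (auto simp: u_def e_def)
  then have "exp u * (1 - e) \<le> (\<Sum>m<10. u ^ m / fact m)"
    using t(2) by (simp add: right_diff_distrib)
  also have "\<dots> \<le> 4811/1000 * (1 - e)"
    by (simp add: u_def e_def lessThan_nat_numeral fact_numeral power_divide)
  finally have "exp u \<le> 4811/1000"
    by (rule mult_right_le_imp_le) (simp add: u_def e_def fact_numeral power_divide)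
  moreover have "exp (pi / 2) \<le> exp u"
    using pi_approx(2) by (simp add: u_def)
  ultimately have "exp (pi / 2) \<le> 4811/1000" by linarith
  then have "pi * exp (pi / 2) \<le> 31416/10000 * (4811/1000)"
    using pi_approx(2) by (intro mult_mono) auto
  then show "pi * exp (pi/2) / 4 < 3.779" by simp
qed

theorem theorem1:
  fixes p :: real
  shows
    "((absolutely_monotonic_on {0<..<1} (G p) \<longleftrightarrow> p \<le> pi * exp (pi/2) / 4)
      \<and> 3.778 \<le> pi * exp (pi/2) / 4 \<and> pi * exp (pi/2) / 4 < 3.779
      \<and> (absolutely_monotonic_on {0<..<1} (\<lambda>x. - G p x) \<longleftrightarrow> p \<ge> exp (pi/2)))
     \<and> (\<forall>k::nat\<ge>1.
          (absolutely_monotonic_on {0<..<1} ((deriv ^^ k) (G p)) \<longleftrightarrow> p \<le> b k / W k)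
        \<and> (absolutely_monotonic_on {0<..<1} (\<lambda>x. - (deriv ^^ k) (G p) x) \<longleftrightarrow> p \<ge> 4))"
proof -
  note iff = absolutely_monotonic_higher_deriv_iff[OF G_power_series[of p]]
  have ratio: "0 \<le> b n - p * W n \<longleftrightarrow> p \<le> b n / W n" "b n - p * W n \<le> 0 \<longleftrightarrow> b n / W n \<le> p" for n
    by (simp_all add: pos_le_divide_eq pos_divide_le_eq)
  have first: "b 1 / W 1 = pi * exp (pi / 2) / 4"
    by (simp only: b_values b_0) (simp add: W_Suc)
  have zeroth: "b 1 / W 1 \<le> b 0 / W 0"
    unfolding b_values using pi_less_4 b_pos[of 0] by (simp add: W_Suc field_simps)
  have le_0: "b n / W n \<le> exp (pi / 2)" for n
    using b_le[of n] by (simp add: b_0 pos_divide_le_eq)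
  have "absolutely_monotonic_on {0<..<1} (G p) \<longleftrightarrow> (\<forall>n. p \<le> b n / W n)"
    using iff(1)[of 0] unfolding ratio by simp
  also have "\<dots> \<longleftrightarrow> p \<le> b 1 / W 1"
    
  proof
    assume p: "p \<le> b 1 / W 1"
    show "\<forall>n. p \<le> b n / W n"
    proof
      fix n
      show "p \<le> b n / W n"
        using p zeroth ratio_mono[of 1 n] by (cases "n = 0") auto
    qed
  qed blast
  finally have 1: "absolutely_monotonic_on {0<..<1} (G p) \<longleftrightarrow> p \<le> pi * exp (pi / 2) / 4"
    unfolding first .
  have "absolutely_monotonic_on {0<..<1} (\<lambda>x. - G p x) \<longleftrightarrow> (\<forall>n. b n / W n \<le> p)"
    using iff(2)[of 0] unfolding ratio by simp
  also have "\<dots> \<longleftrightarrow> exp (pi / 2) \<le> p"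

  proof
    assume "\<forall>n. b n / W n \<le> p"
    from spec[OF this, of 0] show "exp (pi / 2) \<le> p" by (simp add: b_0)
  qed (use le_0 order.trans in blast)
  finally have 2: "absolutely_monotonic_on {0<..<1} (\<lambda>x. - G p x) \<longleftrightarrow> p \<ge> exp (pi/2)" .
  have 3: "absolutely_monotonic_on {0<..<1} ((deriv ^^ k) (G p)) \<longleftrightarrow> p \<le> b k / W k" if "1 \<le> k" for k
    unfolding iff(1) ratio using ratio_mono[OF that] by (meson order.refl order.trans)
  have 4: "absolutely_monotonic_on {0<..<1} (\<lambda>x. - (deriv ^^ k) (G p) x) \<longleftrightarrow> p \<ge> 4" if "1 \<le> k" for k
  proof -
    have "(\<forall>n\<ge>k. b n / W n \<le> p) \<longleftrightarrow> 4 \<le> p"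
    proof
      assume "\<forall>n\<ge>k. b n / W n \<le> p"
      then show "4 \<le> p"
        by (intro eventual_ratio_bounds(1)[of k]) (auto simp: pos_divide_le_eq)
    next
      assume "4 \<le> p"
      then show "\<forall>n\<ge>k. b n / W n \<le> p"
        using ratio_le_4 that by (meson order.trans)
    qed
    then show ?thesis unfolding iff(2) ratio .
  qed
  show ?thesis
    using 1 2 3 4 pi_exp_bounds by blast
qed

end
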